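(* Let $d$ be a positive even integer. Then for each positive integer $n$ there is a unique coefficient sequence $\epsilon=(\epsilon_k)_{k\ge 1}$ satisfying the Chung-Graham rule of expansion for even interval $d$ such that $n=\sum_{k=1}^\infty \epsilon_k F_{2+d(k-1)}$.
   Context: $F$ is the Fibonacci sequence: $F_1=F_2=1$, $F_{k+2}=F_{k+1}+F_k$ for $k\ge1$. $K$ is the sequence with $K_1=1$, $K_2=3$, $K_{k+2}=K_{k+1}+K_k$ for $k\ge 1$. A coefficient sequence is a sequence $\epsilon=(\epsilon_k)_{k\ge1}$ of non-negative integers with only finitely many non-zero entries. For a positive even integer $d$, put $A:=K_d-1$ and $B:=F_{2+d}-1$. A coefficient sequence $\epsilon$ satisfies the Chung-Graham rule of expansion for even interval $d$ if: (1) $0\le\epsilon_1\le B$ and $0\le\epsilon_k\le A$ for all $k\ge2$; (2) if there is an index $m\ge2$ such that $\epsilon_m=A$ and $\epsilon_k=A-1$ for all $2\le k\le m-1$, then $\epsilon_1<B$; (3) if $\epsilon_k=\epsilon_j=A$ for some $2\le k<j$, then there is an index $c$ with $k<c<j$ and $\epsilon_c\le A-2$ (in particular $\epsilon_k=\epsilon_{k+1}=A$ with $k\ge2$ is not allowed). *)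

theory Defs
  imports Main "HOL-Number_Theory.Fib"
begin

(* The sequence starts at index 1 with values 1, 3; the value 2 at index 0 is the one
   forced by running the recurrence backwards. *)
fun K_seq :: "nat \<Rightarrow> nat" where
  "K_seq 0 = 2"
| "K_seq (Suc 0) = 1"
| "K_seq (Suc (Suc k)) = K_seq (Suc k) + K_seq k"

lemma K_seq_from_1:
  "K_seq 1 = 1" "K_seq 2 = 3" "k \<ge> 1 \<Longrightarrow> K_seq (k + 2) = K_seq (k + 1) + K_seq k"
  by (simp_all add: numeral_2_eq_2)

(* Sequences are indexed by k >= 1; the unused entry at 0 is pinned to 0, so that equality
   of functions is equality of coefficient sequences. *)
definition coeff_seq :: "(nat \<Rightarrow> nat) \<Rightarrow> bool" where
  "coeff_seq \<epsilon> \<longleftrightarrow> \<epsilon> 0 = 0 \<and> finite {k. k \<ge> 1 \<and> \<epsilon> k \<noteq> 0}"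

(* For even d > 0 we have K_seq d >= 3 and fib (2 + d) >= 3, so none of the
   subtractions on nat is truncated. *)
definition chung_graham_even :: "nat \<Rightarrow> (nat \<Rightarrow> nat) \<Rightarrow> bool" where
  "chung_graham_even d \<epsilon> \<longleftrightarrow>
     (let A = K_seq d - 1; B = fib (2 + d) - 1 in
        (\<epsilon> 1 \<le> B \<and> (\<forall>k\<ge>2. \<epsilon> k \<le> A)) \<and>
        ((\<exists>m\<ge>2. \<epsilon> m = A \<and> (\<forall>k. 2 \<le> k \<and> k \<le> m - 1 \<longrightarrow> \<epsilon> k = A - 1)) \<longrightarrow> \<epsilon> 1 < B) \<and>
        (\<forall>k j. 2 \<le> k \<and> k < j \<and> \<epsilon> k = A \<and> \<epsilon> j = A \<longrightarrow>
           (\<exists>c. k < c \<and> c < j \<and> \<epsilon> c \<le> A - 2)))"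

definition expansion_value :: "nat \<Rightarrow> (nat \<Rightarrow> nat) \<Rightarrow> nat" where
  "expansion_value d \<epsilon> = (\<Sum>k | k \<ge> 1 \<and> \<epsilon> k \<noteq> 0. \<epsilon> k * fib (2 + d * (k - 1)))"

end

(* The weights G i = fib (2 + d * i) satisfy G (i + 2) = (A + 1) * G (i + 1) - G i. Reading the
   coefficients from the lowest weight upwards, rules (2) and (3) say exactly that a two-state
   automaton never takes a forbidden step: its state, the "carry", is set when the part read so
   far ends in A, A - 1, ..., A - 1 or is B, A - 1, ..., A - 1, and then the next coefficient is
   at most A - 1. Induction along the automaton shows that the first m + 1 coefficients represent a
   number below G (m + 1), and one below G (m + 1) - G m if the carry is not set. Division with
   remainder by the top weight then gives existence and uniqueness. *)
theory Submission imports Defs begin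

section \<open>Weights with a second-order recurrence, and the carry automaton\<close>

locale recurrent_weights =
  fixes G :: "nat \<Rightarrow> nat" and A B :: nat
  assumes A_ge_2: "A \<ge> 2"
    and G_0: "G 0 = 1"
    and G_1: "G 1 = B + 1"
    and G_rec: "G (i + 2) + G i = (A + 1) * G (i + 1)"
    and G_mono: "strict_mono G"
begin

text \<open>\<open>carry \<epsilon> i\<close> is the state after reading the coefficients at indices
  1 to \<open>i + 1\<close>; it governs the one at \<open>i + 2\<close>.\<close>

primrec carry :: "(nat \<Rightarrow> nat) \<Rightarrow> nat \<Rightarrow> bool" where
  "carry \<epsilon> 0 \<longleftrightarrow> \<epsilon> 1 = B"
| "carry \<epsilon> (Suc i) \<longleftrightarrow> \<epsilon> (i + 2) = A \<or> (carry \<epsilon> i \<and> \<epsilon> (i + 2) = A - 1)"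

definition admissible :: "(nat \<Rightarrow> nat) \<Rightarrow> bool" where
  "admissible \<epsilon> \<longleftrightarrow> \<epsilon> 1 \<le> B \<and> (\<forall>i. \<epsilon> (i + 2) \<le> (if carry \<epsilon> i then A - 1 else A))"

definition partial_value :: "(nat \<Rightarrow> nat) \<Rightarrow> nat \<Rightarrow> nat" where
  "partial_value \<epsilon> m = (\<Sum>i<m. \<epsilon> (Suc i) * G i)"

lemma partial_value_Suc: "partial_value \<epsilon> (Suc m) = partial_value \<epsilon> m + \<epsilon> (Suc m) * G m"
  by (simp add: partial_value_def)

lemma G_less_Suc: "G i < G (Suc i)"
  using G_mono by (simp add: strict_mono_def)

lemma G_rec_diff: "G (Suc (Suc i)) + G i = A * G (Suc i) + G (Suc i)"
  using G_rec[of i] by simp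

lemma carry_cong:
  assumes "\<And>k. k \<le> Suc i \<Longrightarrow> \<epsilon> k = \<delta> k"
  shows "carry \<epsilon> i = carry \<delta> i"
  using assms by (induction i) auto

lemma partial_value_cong:
  assumes "\<And>k. k \<le> m \<Longrightarrow> \<epsilon> k = \<delta> k"
  shows "partial_value \<epsilon> m = partial_value \<delta> m"
  unfolding partial_value_def using assms by (intro sum.cong) auto

section \<open>The expansion rules in terms of the carry\<close>

text \<open>A carry is traced back through a run of \<open>A - 1\<close> to its origin, an entry
  \<open>A\<close> or the first coefficient \<open>B\<close>.\<close>

lemma carry_cases:
  assumes "carry \<epsilon> i"
  shows "(\<exists>k. 2 \<le> k \<and> k \<le> Suc i \<and> \<epsilon> k = A \<and> (\<forall>j. k < j \<and> j \<le> Suc i \<longrightarrow> \<epsilon> j = A - 1)) \<or>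
    (\<epsilon> 1 = B \<and> (\<forall>j. 2 \<le> j \<and> j \<le> Suc i \<longrightarrow> \<epsilon> j = A - 1))"
  using assms
proof (induction i)
  case (Suc i)
  show ?case
  proof (cases "\<epsilon> (i + 2) = A")
    case True
    then show ?thesis by (intro disjI1 exI[of _ "i + 2"]) auto
  next
    case False
    with Suc.prems have "carry \<epsilon> i" and top: "\<epsilon> (i + 2) = A - 1" by auto
    from Suc.IH[OF this(1)] show ?thesis
      using top by (auto simp: le_Suc_eq)
  qed
qed auto

text \<open>Later entries \<open>A\<close> are harmless, since each sets the carry afresh. Rule (3)
  needs this generality: without an entry at most \<open>A - 2\<close> in between, only
  \<open>A\<close> and \<open>A - 1\<close> remain.\<close>

lemma carry_from_A:
  assumes "\<epsilon> k = A" "2 \<le> k" "k \<le> Suc i"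
    and "\<And>c. k < c \<Longrightarrow> c \<le> Suc i \<Longrightarrow> \<epsilon> c = A \<or> \<epsilon> c = A - 1"
  shows "carry \<epsilon> i"
  using assms(3,4)
proof (induction i)
  case 0
  then show ?case using assms(2) by simp
next
  case (Suc i)
  show ?case
  proof (cases "k = i + 2")
    case True
    then show ?thesis using assms(1) by simp
  next
    case False
    with Suc have "carry \<epsilon> i" by simp
    with Suc.prems(2)[of "i + 2"] False Suc.prems(1) show ?thesis by auto
  qed
qed

lemma carry_from_B:
  assumes "\<epsilon> 1 = B" and "\<And>k. 2 \<le> k \<Longrightarrow> k \<le> Suc i \<Longrightarrow> \<epsilon> k = A - 1"
  shows "carry \<epsilon> i"
  using assms by (induction i) auto

text \<open>An entry \<open>A\<close> read under a carry breaks rule (3) if the carry started at an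
  \<open>A\<close>, and rule (2) if it started at \<open>B\<close>. Conversely, a violation of
  either rule propagates a carry up to its last \<open>A\<close>.\<close>

lemma admissible_iff:
  "admissible \<epsilon> \<longleftrightarrow>
     (\<epsilon> 1 \<le> B \<and> (\<forall>k\<ge>2. \<epsilon> k \<le> A)) \<and>
     ((\<exists>m\<ge>2. \<epsilon> m = A \<and> (\<forall>k. 2 \<le> k \<and> k \<le> m - 1 \<longrightarrow> \<epsilon> k = A - 1)) \<longrightarrow> \<epsilon> 1 < B) \<and>
     (\<forall>k j. 2 \<le> k \<and> k < j \<and> \<epsilon> k = A \<and> \<epsilon> j = A \<longrightarrow>
        (\<exists>c. k < c \<and> c < j \<and> \<epsilon> c \<le> A - 2))"
  (is "_ \<longleftrightarrow> ?bounds \<and> ?rule2 \<and> ?rule3")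
proof
  assume adm: "admissible \<epsilon>"
  have le: "\<epsilon> k \<le> (if carry \<epsilon> (k - 2) then A - 1 else A)" if "k \<ge> 2" for k
    using adm that unfolding admissible_def by (metis le_add_diff_inverse2)
  have le_A: "\<epsilon> k \<le> A" if "k \<ge> 2" for k
    using le[OF that] by (auto split: if_splits)
  have no_carry: "\<not> carry \<epsilon> (k - 2)" if "k \<ge> 2" "\<epsilon> k = A" for k
    using le[OF that(1)] that(2) A_ge_2 by auto
  have bounds: ?bounds using adm le_A by (simp add: admissible_def)
  moreover have ?rule2
  proof
    assume "\<exists>m\<ge>2. \<epsilon> m = A \<and> (\<forall>k. 2 \<le> k \<and> k \<le> m - 1 \<longrightarrow> \<epsilon> k = A - 1)"
    then obtain m where m: "m \<ge> 2" "\<epsilon> m = A" "\<forall>k. 2 \<le> k \<and> k \<le> m - 1 \<longrightarrow> \<epsilon> k = A - 1"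
      by blast
    have "\<epsilon> 1 \<noteq> B"
      using no_carry[OF m(1,2)] carry_from_B[of \<epsilon> "m - 2"] m(1,3) by auto
    with bounds show "\<epsilon> 1 < B" by simp
  qed
  moreover have ?rule3
  proof (intro allI impI, rule ccontr)
    fix k j
    assume kj: "2 \<le> k \<and> k < j \<and> \<epsilon> k = A \<and> \<epsilon> j = A"
      and none: "\<not> (\<exists>c. k < c \<and> c < j \<and> \<epsilon> c \<le> A - 2)"
    have "\<epsilon> c = A \<or> \<epsilon> c = A - 1" if "k < c" "c \<le> Suc (j - 2)" for c
    proof -
      have "\<not> \<epsilon> c \<le> A - 2" using none that kj by auto
      with le_A[of c] that kj show ?thesis by linarith
    qed
    then have "carry \<epsilon> (j - 2)" using kj by (intro carry_from_A[of \<epsilon> k]) auto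
    with no_carry[of j] kj show False by auto
  qed
  ultimately show "?bounds \<and> ?rule2 \<and> ?rule3" by blast
next
  assume rules: "?bounds \<and> ?rule2 \<and> ?rule3"
  have "\<epsilon> (i + 2) \<le> A - 1" if c: "carry \<epsilon> i" for i
  proof (rule ccontr)
    assume "\<not> \<epsilon> (i + 2) \<le> A - 1"
    moreover have "\<epsilon> (i + 2) \<le> A" using rules by simp
    ultimately have top: "\<epsilon> (i + 2) = A" by linarith
    from carry_cases[OF c] show False
    proof
      assume "\<exists>k. 2 \<le> k \<and> k \<le> Suc i \<and> \<epsilon> k = A \<and> (\<forall>j. k < j \<and> j \<le> Suc i \<longrightarrow> \<epsilon> j = A - 1)"
      then obtain k where k: "2 \<le> k" "k \<le> Suc i" "\<epsilon> k = A"
        "\<forall>j. k < j \<and> j \<le> Suc i \<longrightarrow> \<epsilon> j = A - 1" by blast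
      have "2 \<le> k \<and> k < i + 2 \<and> \<epsilon> k = A \<and> \<epsilon> (i + 2) = A" using k top by simp
      then obtain c where "k < c" "c < i + 2" "\<epsilon> c \<le> A - 2" using rules by blast
      moreover from this k(4) have "\<epsilon> c = A - 1" by simp
      ultimately show False using A_ge_2 by simp
    next
      assume "\<epsilon> 1 = B \<and> (\<forall>j. 2 \<le> j \<and> j \<le> Suc i \<longrightarrow> \<epsilon> j = A - 1)"
      moreover from this top have "\<exists>m\<ge>2. \<epsilon> m = A \<and> (\<forall>k. 2 \<le> k \<and> k \<le> m - 1 \<longrightarrow> \<epsilon> k = A - 1)"
        by (intro exI[of _ "i + 2"]) simp
      ultimately show False using rules by simp
    qed
  qed
  then show "admissible \<epsilon>" using rules by (simp add: admissible_def)
qed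

section \<open>Upper bounds for partial sums\<close>

text \<open>The two bounds need each other: a top coefficient \<open>A\<close> occurs only without
  carry, and then the sharper bound on the lower part pays for the \<open>G m\<close> subtracted in
  the recurrence.\<close>

lemma partial_value_less_step:
  assumes adm: "admissible \<epsilon>"
  shows "partial_value \<epsilon> (Suc m) < G (Suc m) \<and>
    (\<not> carry \<epsilon> m \<longrightarrow> partial_value \<epsilon> (Suc m) + G m < G (Suc m))"
proof (induction m)
  case 0
  then show ?case
    using adm G_0 G_1 by (auto simp: partial_value_def admissible_def)
next
  case (Suc m)
  define q where "q = \<epsilon> (m + 2)"
  define P where "P = partial_value \<epsilon> (Suc m)"
  define g where "g = G (Suc m)"
  have val: "partial_value \<epsilon> (Suc (Suc m)) = P + q * g"
    by (simp add: P_def q_def g_def partial_value_Suc)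
  have rec: "G (Suc (Suc m)) + G m = A * g + g" and "G m < g"
    using G_rec_diff[of m] G_less_Suc[of m] by (auto simp: g_def)
  have q: "q \<le> (if carry \<epsilon> m then A - 1 else A)"
    using adm by (simp add: admissible_def q_def)
  have IH: "P < g" "\<not> carry \<epsilon> m \<Longrightarrow> P + G m < g"
    using Suc by (auto simp: P_def g_def)
  have carry_Suc: "carry \<epsilon> (Suc m) \<longleftrightarrow> q = A \<or> (carry \<epsilon> m \<and> q = A - 1)"
    by (simp add: q_def)
  \<comment> \<open>The products \<open>q * g\<close> are nonlinear; these instances reduce the rest
    to linear arithmetic.\<close>
  have steps: "q \<le> A \<Longrightarrow> q * g \<le> A * g" "q \<le> A - 1 \<Longrightarrow> q * g + g \<le> A * g"
    "q \<le> A - 2 \<Longrightarrow> q * g + 2 * g \<le> A * g"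
    using mult_le_mono1[of q A g] mult_le_mono1[of "q + 1" A g] mult_le_mono1[of "q + 2" A g] A_ge_2
    unfolding add_mult_distrib by linarith+
  show ?case
  proof (cases "carry \<epsilon> m")
    case True
    \<comment> \<open>Here \<open>P < g\<close> gives a value below \<open>A * g\<close>, which is
      below the next weight because \<open>G m < g\<close>. If the carry ends, \<open>q\<close>
      drops by one more and frees another \<open>g\<close>.\<close>
    then have "q \<le> A - 1" and "\<not> carry \<epsilon> (Suc m) \<Longrightarrow> q \<le> A - 2"
      using q carry_Suc by auto
    then show ?thesis
      using steps IH(1) rec \<open>G m < g\<close> val unfolding g_def[symmetric] by linarith
  next
    case False
    then have "q \<le> A" and "\<not> carry \<epsilon> (Suc m) \<Longrightarrow> q \<le> A - 1"
      using q carry_Suc by auto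
    then show ?thesis
      using steps IH(2)[OF False] rec val unfolding g_def[symmetric] by linarith
  qed
qed

lemma partial_value_less:
  assumes "admissible \<epsilon>"
  shows "partial_value \<epsilon> m < G m"
  using partial_value_less_step[OF assms] G_0 by (cases m) (auto simp: partial_value_def)

section \<open>Uniqueness and existence of representations\<close>

text \<open>The lower part is below \<open>G m\<close>, so the top coefficient and the lower part
  are the quotient and remainder of the value by \<open>G m\<close>.\<close>

lemma partial_value_inject:
  assumes adm: "admissible \<epsilon>" "admissible \<delta>"
    and "partial_value \<epsilon> m = partial_value \<delta> m"
  shows "\<forall>k. 1 \<le> k \<and> k \<le> m \<longrightarrow> \<epsilon> k = \<delta> k"
  using assms(3)
proof (induction m)
  case (Suc m)
  have div: "partial_value \<gamma> (Suc m) div G m = \<gamma> (Suc m)"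
    and mod: "partial_value \<gamma> (Suc m) mod G m = partial_value \<gamma> m"
    if "admissible \<gamma>" for \<gamma>
    using partial_value_less[OF that, of m] by (simp_all add: partial_value_Suc)
  have "\<epsilon> (Suc m) = \<delta> (Suc m)"
    using div[OF adm(1)] div[OF adm(2)] Suc.prems by simp
  moreover have "partial_value \<epsilon> m = partial_value \<delta> m"
    using mod[OF adm(1)] mod[OF adm(2)] Suc.prems by simp
  ultimately show ?case using Suc.IH by (auto simp: le_Suc_eq)
qed auto

(* The clause on the carry is what makes the induction go through: a remainder that must be
   followed by the coefficient A has to be represented without carry. *)
lemma admissible_representation:
  assumes "n < G (Suc m)"
  shows "\<exists>\<epsilon>. admissible \<epsilon> \<and> \<epsilon> 0 = 0 \<and> (\<forall>k>Suc m. \<epsilon> k = 0) \<and>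
    partial_value \<epsilon> (Suc m) = n \<and> (n + G m < G (Suc m) \<longrightarrow> \<not> carry \<epsilon> m)"
  using assms
proof (induction m arbitrary: n)
  case 0
  \<comment> \<open>Here \<open>n \<le> B\<close>, so one coefficient suffices;
    \<open>n + G 0 < G 1\<close> says \<open>n < B\<close>, hence no carry.\<close>
  then show ?case
    using G_0 G_1
    by (intro exI[of _ "(\<lambda>_. 0)(1 := n)"]) (auto simp: admissible_def partial_value_def)
next
  case (Suc m)
  define g where "g = G (Suc m)"
  define q where "q = n div g"
  define r where "r = n mod g"
  have rec: "G (Suc (Suc m)) + G m = A * g + g" and "G m < g"
    using G_rec_diff[of m] G_less_Suc[of m] by (auto simp: g_def)
  have n: "n = q * g + r" and "r < g"
    using \<open>G m < g\<close> by (simp_all add: q_def r_def)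
  obtain \<delta> where \<delta>: "admissible \<delta>" "\<delta> 0 = 0" "\<forall>k>Suc m. \<delta> k = 0"
      "partial_value \<delta> (Suc m) = r" "r + G m < g \<longrightarrow> \<not> carry \<delta> m"
    using Suc.IH[of r] \<open>r < g\<close> unfolding g_def by blast
  define \<epsilon> where "\<epsilon> = \<delta>(m + 2 := q)"
  have carry_eq: "carry \<epsilon> i = carry \<delta> i" if "i \<le> m" for i
    using that by (intro carry_cong) (auto simp: \<epsilon>_def)
  have n_less: "n + G m < A * g + g"
    using Suc.prems rec by simp
  have steps: "A < q \<Longrightarrow> A * g + g \<le> q * g" "q \<ge> A \<Longrightarrow> A * g \<le> q * g"
    "q \<ge> A - 1 \<Longrightarrow> A * g \<le> q * g + g"
    using mult_le_mono1[of "A + 1" q g] mult_le_mono1[of A q g] mult_le_mono1[of A "q + 1" g]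
    unfolding add_mult_distrib by linarith+
  have "q \<le> A" using steps(1) n n_less by linarith
  moreover have q_carry: "q \<le> A - 1" if "carry \<delta> m"
  proof -
    \<comment> \<open>A carry forces a large remainder \<open>r\<close>, so \<open>q \<ge> A\<close>
      would push \<open>n\<close> up to \<open>A * g + g - G m\<close>, the next weight.\<close>
    have "r + G m \<ge> g" using \<delta>(5) that by linarith
    then have "\<not> A \<le> q" using steps(2) n n_less by linarith
    then show ?thesis by simp
  qed
  ultimately have top: "q \<le> (if carry \<epsilon> m then A - 1 else A)"
    using carry_eq by simp
  have "\<epsilon> (i + 2) \<le> (if carry \<epsilon> i then A - 1 else A)" for i
  proof -
    consider "i < m" | "i = m" | "i > m" by linarith
    then show ?thesis
    proof cases
      case 1
      then show ?thesis using \<delta>(1) carry_eq by (simp add: admissible_def \<epsilon>_def)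
    next
      case 2
      then show ?thesis using top by (simp add: \<epsilon>_def)
    next
      case 3
      then show ?thesis using \<delta>(3) by (simp add: \<epsilon>_def)
    qed
  qed
  then have "admissible \<epsilon>"
    using \<delta>(1) by (simp add: admissible_def \<epsilon>_def)
  moreover have "partial_value \<epsilon> (Suc (Suc m)) = n"
  proof -
    have "partial_value \<epsilon> (Suc m) = r"
      using partial_value_cong[of "Suc m" \<epsilon> \<delta>] \<delta>(4) by (simp add: \<epsilon>_def)
    then show ?thesis
      using n by (simp add: partial_value_Suc[of _ "Suc m"] \<epsilon>_def g_def)
  qed
  moreover have "\<not> carry \<epsilon> (Suc m)" if small: "n + g < G (Suc (Suc m))"
  proof
    assume "carry \<epsilon> (Suc m)"
    then have "q = A \<or> (carry \<delta> m \<and> q = A - 1)"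
      using carry_eq[of m] by (simp add: \<epsilon>_def)
    then show False
    proof
      assume "q = A"
      then show False using steps(2) small rec n by linarith
    next
      \<comment> \<open>Now \<open>n + g = A * g + r\<close>, and the carry makes \<open>r\<close>
        at least \<open>g - G m\<close>, so \<open>n + g\<close> reaches the next weight.\<close>
      assume *: "carry \<delta> m \<and> q = A - 1"
      then have "r + G m \<ge> g" using \<delta>(5) by linarith
      then show False using * steps(3) small rec n by linarith
    qed
  qed
  moreover have "\<epsilon> 0 = 0" "\<forall>k>Suc (Suc m). \<epsilon> k = 0"
    using \<delta>(2,3) by (auto simp: \<epsilon>_def)
  ultimately show ?case
    unfolding g_def by blast
qed

text \<open>A sum over the support equals \<open>partial_value\<close> at any index beyond it, so
  the finite results apply.\<close>

lemma unique_admissible_representation: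
  "\<exists>!\<epsilon>. admissible \<epsilon> \<and> coeff_seq \<epsilon> \<and> n = (\<Sum>k | k \<ge> 1 \<and> \<epsilon> k \<noteq> 0. \<epsilon> k * G (k - 1))"
proof -
  have bound: "\<exists>N. \<forall>k>N. \<epsilon> k = 0" if "coeff_seq \<epsilon>" for \<epsilon>
  proof -
    have "finite {k. k \<ge> 1 \<and> \<epsilon> k \<noteq> 0}" using that by (simp add: coeff_seq_def)
    then obtain N where N: "\<forall>k\<in>{k. k \<ge> 1 \<and> \<epsilon> k \<noteq> 0}. k \<le> N"
      using finite_nat_set_iff_bounded_le by blast
    have "\<epsilon> k = 0" if "k > N" for k
    proof (rule ccontr)
      assume "\<epsilon> k \<noteq> 0"
      with that have "k \<in> {k. k \<ge> 1 \<and> \<epsilon> k \<noteq> 0}" by simp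
      with N that show False using leD by blast
    qed
    then show ?thesis by blast
  qed
  have val: "(\<Sum>k | k \<ge> 1 \<and> \<epsilon> k \<noteq> 0. \<epsilon> k * G (k - 1)) = partial_value \<epsilon> N"
    if "\<forall>k>N. \<epsilon> k = 0" for \<epsilon> N
  proof -
    have "partial_value \<epsilon> N = (\<Sum>k=1..N. \<epsilon> k * G (k - 1))"
      unfolding partial_value_def
      by (rule sum.reindex_bij_witness[of _ "\<lambda>k. k - 1" Suc]) auto
    also have "\<dots> = (\<Sum>k | k \<ge> 1 \<and> \<epsilon> k \<noteq> 0. \<epsilon> k * G (k - 1))"
      using that by (intro sum.mono_neutral_right) (auto simp: not_less[symmetric])
    finally show ?thesis by simp
  qed
  show ?thesis
  proof (rule ex_ex1I)
    \<comment> \<open>A strictly increasing sequence of naturals satisfies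
      \<open>k \<le> G k\<close>, so \<open>n + 1\<close> coefficients are enough.\<close>
    have "n < G (Suc n)"
      using strict_mono_imp_increasing[OF G_mono, of "Suc n"] by simp
    from admissible_representation[OF this] obtain \<epsilon> where
      \<epsilon>: "admissible \<epsilon>" "\<epsilon> 0 = 0" "\<forall>k>Suc n. \<epsilon> k = 0" "partial_value \<epsilon> (Suc n) = n"
      by blast
    have "{k. k \<ge> 1 \<and> \<epsilon> k \<noteq> 0} \<subseteq> {..Suc n}"
      using \<epsilon>(3) by (auto simp: not_less[symmetric])
    then have "coeff_seq \<epsilon>"
      using \<epsilon>(2) finite_subset by (auto simp: coeff_seq_def)
    with \<epsilon> val[OF \<epsilon>(3)]
    show "\<exists>\<epsilon>. admissible \<epsilon> \<and> coeff_seq \<epsilon> \<and> n = (\<Sum>k | k \<ge> 1 \<and> \<epsilon> k \<noteq> 0. \<epsilon> k * G (k - 1))"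
      by auto
  next
    fix \<epsilon> \<delta>
    assume \<epsilon>: "admissible \<epsilon> \<and> coeff_seq \<epsilon> \<and> n = (\<Sum>k | k \<ge> 1 \<and> \<epsilon> k \<noteq> 0. \<epsilon> k * G (k - 1))"
      and \<delta>: "admissible \<delta> \<and> coeff_seq \<delta> \<and> n = (\<Sum>k | k \<ge> 1 \<and> \<delta> k \<noteq> 0. \<delta> k * G (k - 1))"
    obtain M N where M: "\<forall>k>M. \<epsilon> k = 0" and N: "\<forall>k>N. \<delta> k = 0"
      using bound \<epsilon> \<delta> by meson
    define L where "L = max M N"
    have L: "\<forall>k>L. \<epsilon> k = 0" "\<forall>k>L. \<delta> k = 0" using M N by (auto simp: L_def)
    have "partial_value \<epsilon> L = partial_value \<delta> L"
      using val[OF L(1)] val[OF L(2)] \<epsilon> \<delta> by simp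
    then have *: "\<forall>k. 1 \<le> k \<and> k \<le> L \<longrightarrow> \<epsilon> k = \<delta> k"
      using partial_value_inject \<epsilon> \<delta> by blast
    show "\<epsilon> = \<delta>"
    proof
      fix k
      consider "k = 0" | "1 \<le> k \<and> k \<le> L" | "k > L" by linarith
      then show "\<epsilon> k = \<delta> k"
        using * L \<epsilon> \<delta> by cases (auto simp: coeff_seq_def)
    qed
  qed
qed

end

section \<open>Fibonacci and Lucas identities\<close>

text \<open>\<open>K_seq\<close> is the Lucas sequence. For even \<open>d\<close> this is the
  recurrence of the weights; the alternating sign is why it is stated over the integers.\<close>

lemma K_seq_mult_fib:
  "int (K_seq d) * int (fib (n + d)) = int (fib (n + 2 * d)) + (-1) ^ d * int (fib n)"
proof (induction d arbitrary: n rule: K_seq.induct)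
  case (3 d)
  have fib_Suc2: "fib (k + 2) = fib (k + 1) + fib k" for k
    by simp
  have "int (K_seq (Suc (Suc d))) * int (fib (n + Suc (Suc d))) =
      int (K_seq (Suc d)) * int (fib ((n + 1) + Suc d)) + int (K_seq d) * int (fib ((n + 2) + d))"
    by (simp add: algebra_simps)
  also have "\<dots> = int (fib (n + 1 + 2 * Suc d)) + (-1) ^ Suc d * int (fib (n + 1)) +
      (int (fib (n + 2 + 2 * d)) + (-1) ^ d * int (fib (n + 2)))"
    by (simp only: 3)
  \<comment> \<open>The signed terms differ in sign and leave
    \<open>fib (n + 2) - fib (n + 1) = fib n\<close>; the others are consecutive Fibonacci
    numbers.\<close>
  also have "\<dots> = int (fib (n + 2 * Suc (Suc d))) + (-1) ^ Suc (Suc d) * int (fib n)"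
    using fib_Suc2[of n] fib_Suc2[of "n + 2 * d + 2"] by (simp add: algebra_simps)
  finally show ?case .
qed auto

lemma K_seq_ge_3: "K_seq (Suc (Suc k)) \<ge> 3"
  by (induction k rule: K_seq.induct) auto

lemma strict_mono_fib_progression:
  assumes "d > 0"
  shows "strict_mono (\<lambda>i. fib (2 + d * i))"
proof -
  have less: "fib (2 + k) < fib (2 + Suc k)" for k
    using fib_neq_0_nat[of "Suc k"] by simp
  have "strict_mono (\<lambda>k. fib (2 + k))"
    using less by (simp only: strict_mono_Suc_iff) blast
  then show ?thesis
    using assms by (simp add: strict_mono_def)
qed

theorem theorem2p2:
  fixes d n :: nat
  assumes "d > 0" and "even d" and "n > 0"
  shows "\<exists>!\<epsilon>. coeff_seq \<epsilon> \<and> chung_graham_even d \<epsilon> \<and> n = expansion_value d \<epsilon>"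
proof -
  \<comment> \<open>Evenness excludes \<open>d = 1\<close>, where the value is 1; the bound supplies
    \<open>A \<ge> 2\<close>.\<close>
  have K: "K_seq d \<ge> 3"
    using assms(1,2) K_seq_ge_3[of "d - 2"] by (cases d rule: K_seq.cases) auto
  have rec: "fib (2 + d * (i + 2)) + fib (2 + d * i) = K_seq d * fib (2 + d * (i + 1))" for i
  proof -
    have idx: "2 + d * (i + 1) = 2 + d * i + d" "2 + d * (i + 2) = 2 + d * i + 2 * d"
      by (simp_all add: algebra_simps)
    have "int (K_seq d * fib (2 + d * (i + 1))) = int (fib (2 + d * (i + 2)) + fib (2 + d * i))"
      unfolding idx using K_seq_mult_fib[of d "2 + d * i"] assms(2) by (simp del: fib.simps)
    then show ?thesis by linarith
  qed
  \<comment> \<open>Here \<open>A + 1\<close> is \<open>K_seq d\<close> and \<open>B + 1\<close> is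
    \<open>fib (2 + d)\<close>, both positive, so the subtractions are exact.\<close>
  interpret recurrent_weights "\<lambda>i. fib (2 + d * i)" "K_seq d - 1" "fib (2 + d) - 1"
    using K rec strict_mono_fib_progression[OF assms(1)] fib_neq_0_nat[of "2 + d"]
    by unfold_locales (auto simp del: fib.simps)
  have "chung_graham_even d \<epsilon> \<longleftrightarrow> admissible \<epsilon>" for \<epsilon>
    unfolding chung_graham_even_def Let_def admissible_iff ..
  then show ?thesis
    using unique_admissible_representation[of n]
    by (simp only: expansion_value_def conj_ac)
qed

end
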